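(* Let $L$ be a ProbLog program, let $\mathbf{Q},\mathbf{E}\subset \mathbf{At}$ be sets of ground (probabilistic or derived) atoms of $L$ (the query atoms and the evidence atoms), and let $\mathbf{e}$ be a vector of truth values for the atoms in $\mathbf{E}$ such that $P_L(\mathbf{E}=\mathbf{e})>0$. Let $L_g$ be the relevant ground program for $L$ with respect to $\mathbf{Q}$ and $\mathbf{E}=\mathbf{e}$. Then $L$ and $L_g$ specify the same conditional distribution $P(\mathbf{Q}\mid \mathbf{E}=\mathbf{e})$; that is, for every joint truth-value assignment $\mathbf{q}$ to $\mathbf{Q}$, $$P_L(\mathbf{Q}=\mathbf{q}\mid \mathbf{E}=\mathbf{e}) = P_{L_g}(\mathbf{Q}=\mathbf{q}\mid \mathbf{E}=\mathbf{e}).$$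
   Context: **Logic programs.** A (normal) logic program is a set of rules $h \leftarrow b_1,\dots,b_n$, where the head $h$ is an atom and the body literals $b_i$ are atoms or negated atoms. A fact is a rule with empty (true) body. Rules are universally quantified and are identified with their groundings over the Herbrand universe. $WFM(P)$ denotes the (in general three-valued) well-founded model of a logic program $P$; for negation-free $P$ it is the least Herbrand model. A *world* is a (two-valued) assignment of truth values to all ground atoms under consideration. **ProbLog programs.** A ProbLog program $L$ consists of a set of probabilistic facts $p::f$ ($f$ an atom, $p\in[0,1]$) and a set $R$ of logic program rules. Ground instances of the facts $f$ are called ground probabilistic atoms; ground instances of rule heads are called derived atoms. These two sets must be disjoint. Each ground probabilistic atom $f$ has one associated probability $p_f$, and there are finitely many ground probabilistic atoms. $\mathbf{At}$ is the set of all ground probabilistic and derived atoms. **Semantics.** A *total choice* $C$ is a subset of the set $F$ of ground probabilistic atoms; its probability is $\prod_{f\in C}p_f\prod_{f\in F\setminus C}(1-p_f)$. A world $\omega$ is a *model* of $L$ if $WFM(C\cup R)=\omega$ for some total choice $C$ (then $C$ is the set of probabilistic atoms true in $\omega$). Define $P_L(\omega)$ to be the probability of this $C$ if $\omega$ is a model of $L$, and $P_L(\omega)=0$ otherwise. The probability of an event is the sum of $P_L(\omega)$ over the worlds satisfying it, and conditional probabilities are the corresponding ratios. Standing assumption: for the given program $L$, $WFM(C\cup R)$ is two-valued for every total choice $C$. The same definitions of models and $P$ are applied to $L_g$. **Relevant ground program.** Fix $\mathbf{Q}$ and $\mathbf{E}=\mathbf{e}$. A ground rule is *inactive* if its body contains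 a literal that is false in the evidence (an atom of $\mathbf{E}$ that is false in $\mathbf{e}$, or the negation of an atom of $\mathbf{E}$ that is true in $\mathbf{e}$). The *relevant atoms* are those reached by backchaining over the ground rules starting from $\mathbf{Q}\cup\mathbf{E}$ while omitting inactive rules: they form the smallest set of ground atoms that contains $\mathbf{Q}\cup\mathbf{E}$ and contains every atom occurring (positively or negatively) in the body of any ground rule of $L$ that is not inactive and whose head is in the set. The relevant ground program $L_g$ is the ground ProbLog program whose rules are the ground rules of $L$ that are not inactive and have a relevant head, and whose probabilistic facts are the ground probabilistic facts $p_f::f$ of $L$ with $f$ relevant. Worlds of $L_g$ are truth assignments to the relevant atoms. *)

theory Defs
  imports "HOL-Analysis.Infinite_Sum"
begin

section \<open>Ground normal logic programs and the well-founded model\<close>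

datatype (atoms_of_literal: 'a) literal = Pos 'a | Neg 'a

datatype (atoms_of_rule: 'a) rule = Rule (head: 'a) (body: "'a literal list")

fun compl :: "'a literal \<Rightarrow> 'a literal" where
  "compl (Pos a) = Neg a"
| "compl (Neg a) = Pos a"

text \<open>
  A partial (three-valued) interpretation is the set of literals that are true in it.  The
  well-founded model is the one of Van Gelder, Ross and Schlipf: the least fixed point of the
  operator that adds the immediate consequences and the negations of the atoms of the greatest
  unfounded set.  The set \<open>B\<close> consists of the ground atoms under consideration.
\<close>

definition unfounded :: "'a rule set \<Rightarrow> 'a literal set \<Rightarrow> 'a set \<Rightarrow> bool" where
  "unfounded R I U \<longleftrightarrow>
     (\<forall>r\<in>R. head r \<in> U \<longrightarrow>
        (\<exists>l\<in>set (body r). compl l \<in> I) \<or> (\<exists>b\<in>U. Pos b \<in> set (body r)))"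

definition greatest_unfounded :: "'a set \<Rightarrow> 'a rule set \<Rightarrow> 'a literal set \<Rightarrow> 'a set" where
  "greatest_unfounded B R I = \<Union>{U. U \<subseteq> B \<and> unfounded R I U}"

definition consequences :: "'a rule set \<Rightarrow> 'a literal set \<Rightarrow> 'a set" where
  "consequences R I = {head r | r. r \<in> R \<and> set (body r) \<subseteq> I}"

definition wf_step :: "'a set \<Rightarrow> 'a rule set \<Rightarrow> 'a literal set \<Rightarrow> 'a literal set" where
  "wf_step B R I = Pos ` consequences R I \<union> Neg ` greatest_unfounded B R I"

definition WFM :: "'a set \<Rightarrow> 'a rule set \<Rightarrow> 'a literal set" where
  "WFM B R = lfp (wf_step B R)"

lemma mono_wf_step: "mono (wf_step B R)"
proof (rule monoI)
  fix I J :: "'a literal set"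
  assume IJ: "I \<subseteq> J"
  have "consequences R I \<subseteq> consequences R J"
    using IJ unfolding consequences_def by blast
  moreover have "unfounded R J U" if "unfounded R I U" for U
    using that IJ unfolding unfounded_def by blast
  then have "greatest_unfounded B R I \<subseteq> greatest_unfounded B R J"
    unfolding greatest_unfounded_def by blast
  ultimately show "wf_step B R I \<subseteq> wf_step B R J"
    unfolding wf_step_def by blast
qed

definition two_valued :: "'a set \<Rightarrow> 'a literal set \<Rightarrow> bool" where
  "two_valued B I \<longleftrightarrow> (\<forall>a\<in>B. (Pos a \<in> I) \<noteq> (Neg a \<in> I))"

text \<open>A world is represented by the set of its true atoms.\<close>

definition literals_of_world :: "'a set \<Rightarrow> 'a set \<Rightarrow> 'a literal set" where
  "literals_of_world B \<omega> = Pos ` \<omega> \<union> Neg ` (B - \<omega>)"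


section \<open>Semantics of ground ProbLog programs\<close>

text \<open>
  A program is polymorphic in its atoms: first-order programs have first-order atoms, and their
  groundings have ground atoms.  A probabilistic fact \<open>p::f\<close> is the pair \<open>(p, f)\<close>.
\<close>

record 'a problog =
  pfacts :: "(real \<times> 'a) set"
  rules :: "'a rule set"

text \<open>
  The field \<open>base\<close> contains the atoms to which the worlds of the program assign truth values.
  It is explicit because a relevant ground program may have relevant atoms that occur neither
  in its rules nor in its probabilistic facts.
\<close>

record 'a ground_problog = "'a problog" +
  base :: "'a set"

definition prob_atoms :: "('a, 'b) problog_scheme \<Rightarrow> 'a set" where
  "prob_atoms G = snd ` pfacts G"

definition derived_atoms :: "('a, 'b) problog_scheme \<Rightarrow> 'a set" where
  "derived_atoms G = head ` rules G"

definition fact_prob :: "('a, 'b) problog_scheme \<Rightarrow> 'a \<Rightarrow> real" where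
  "fact_prob G f = (THE p. (p, f) \<in> pfacts G)"

definition choice_prob :: "'a ground_problog \<Rightarrow> 'a set \<Rightarrow> real" where
  "choice_prob G C =
     (\<Prod>f\<in>C. fact_prob G f) * (\<Prod>f\<in>prob_atoms G - C. 1 - fact_prob G f)"

definition choice_WFM :: "'a ground_problog \<Rightarrow> 'a set \<Rightarrow> 'a literal set" where
  "choice_WFM G C = WFM (base G) ((\<lambda>f. Rule f []) ` C \<union> rules G)"

definition worlds :: "'a ground_problog \<Rightarrow> 'a set set" where
  "worlds G = Pow (base G)"

definition is_model :: "'a ground_problog \<Rightarrow> 'a set \<Rightarrow> bool" where
  "is_model G \<omega> \<longleftrightarrow> \<omega> \<in> worlds G \<and>
     (\<exists>C\<subseteq>prob_atoms G. choice_WFM G C = literals_of_world (base G) \<omega>)"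

text \<open>
  Since probabilistic atoms are not heads of rules, the total choice that yields the model
  \<open>\<omega>\<close> is \<open>\<omega> \<inter> prob_atoms G\<close>.
\<close>

definition world_prob :: "'a ground_problog \<Rightarrow> 'a set \<Rightarrow> real" where
  "world_prob G \<omega> = (if is_model G \<omega> then choice_prob G (\<omega> \<inter> prob_atoms G) else 0)"

text \<open>
  There may be infinitely many worlds, but only finitely many of them are models, so the
  infinite sum has finite support.
\<close>

definition event_prob :: "'a ground_problog \<Rightarrow> 'a set set \<Rightarrow> real" where
  "event_prob G A = (\<Sum>\<^sub>\<infinity>\<omega>\<in>worlds G \<inter> A. world_prob G \<omega>)"

definition cond_event_prob :: "'a ground_problog \<Rightarrow> 'a set set \<Rightarrow> 'a set set \<Rightarrow> real" where
  "cond_event_prob G A B = event_prob G (A \<inter> B) / event_prob G B"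

definition assignment_event :: "'a set \<Rightarrow> ('a \<Rightarrow> bool) \<Rightarrow> 'a set set" where
  "assignment_event X v = {\<omega>. \<forall>a\<in>X. a \<in> \<omega> \<longleftrightarrow> v a}"


section \<open>The relevant ground program\<close>

fun false_in_evidence :: "'a set \<Rightarrow> ('a \<Rightarrow> bool) \<Rightarrow> 'a literal \<Rightarrow> bool" where
  "false_in_evidence E e (Pos a) \<longleftrightarrow> a \<in> E \<and> \<not> e a"
| "false_in_evidence E e (Neg a) \<longleftrightarrow> a \<in> E \<and> e a"

definition inactive :: "'a set \<Rightarrow> ('a \<Rightarrow> bool) \<Rightarrow> 'a rule \<Rightarrow> bool" where
  "inactive E e r \<longleftrightarrow> (\<exists>l\<in>set (body r). false_in_evidence E e l)"

inductive_set relevant_atoms ::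
  "'a ground_problog \<Rightarrow> 'a set \<Rightarrow> 'a set \<Rightarrow> ('a \<Rightarrow> bool) \<Rightarrow> 'a set"
  for G Q E e where
  start: "a \<in> Q \<union> E \<Longrightarrow> a \<in> relevant_atoms G Q E e"
| backchain: "\<lbrakk>r \<in> rules G; \<not> inactive E e r; head r \<in> relevant_atoms G Q E e;
     l \<in> set (body r); a \<in> atoms_of_literal l\<rbrakk> \<Longrightarrow> a \<in> relevant_atoms G Q E e"

definition relevant_program ::
  "'a ground_problog \<Rightarrow> 'a set \<Rightarrow> 'a set \<Rightarrow> ('a \<Rightarrow> bool) \<Rightarrow> 'a ground_problog" where
  "relevant_program G Q E e =
     \<lparr>pfacts = {(p, f) \<in> pfacts G. f \<in> relevant_atoms G Q E e},
      rules = {r \<in> rules G. \<not> inactive E e r \<and> head r \<in> relevant_atoms G Q E e},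
      base = relevant_atoms G Q E e\<rparr>"


section \<open>First-order ProbLog programs and their groundings\<close>

datatype ('f, 'v) fo_term = Var 'v | Fun 'f "('f, 'v) fo_term list"

datatype ('p, 'f, 'v) fo_atom = Atom 'p (args: "('f, 'v) fo_term list")

fun subst_term :: "('v \<Rightarrow> ('f, 'v) fo_term) \<Rightarrow> ('f, 'v) fo_term \<Rightarrow> ('f, 'v) fo_term" where
  "subst_term \<sigma> (Var x) = \<sigma> x"
| "subst_term \<sigma> (Fun f ts) = Fun f (map (subst_term \<sigma>) ts)"

fun subst_atom :: "('v \<Rightarrow> ('f, 'v) fo_term) \<Rightarrow> ('p, 'f, 'v) fo_atom \<Rightarrow> ('p, 'f, 'v) fo_atom" where
  "subst_atom \<sigma> (Atom p ts) = Atom p (map (subst_term \<sigma>) ts)"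

text \<open>Function symbols are identified by name and arity; constants have arity zero.\<close>

fun term_symbols :: "('f, 'v) fo_term \<Rightarrow> ('f \<times> nat) set" where
  "term_symbols (Var x) = {}"
| "term_symbols (Fun f ts) = insert (f, length ts) (\<Union>t\<in>set ts. term_symbols t)"

definition program_atoms :: "('a, 'b) problog_scheme \<Rightarrow> 'a set" where
  "program_atoms L = prob_atoms L \<union> (\<Union>r\<in>rules L. atoms_of_rule r)"

definition program_symbols :: "('p, 'f, 'v) fo_atom problog \<Rightarrow> ('f \<times> nat) set" where
  "program_symbols L = (\<Union>a\<in>program_atoms L. \<Union>t\<in>set (args a). term_symbols t)"

text \<open>
  As usual, a program without constants is given an arbitrary one, so that its Herbrand
  universe is nonempty.
\<close>

definition signature :: "('p, 'f, 'v) fo_atom problog \<Rightarrow> ('f \<times> nat) set" where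
  "signature L =
     (if \<exists>c. (c, 0) \<in> program_symbols L then program_symbols L
      else insert (undefined, 0) (program_symbols L))"

inductive_set herbrand_universe :: "('p, 'f, 'v) fo_atom problog \<Rightarrow> ('f, 'v) fo_term set"
  for L where
  "\<lbrakk>(f, length ts) \<in> signature L; \<forall>t\<in>set ts. t \<in> herbrand_universe L\<rbrakk>
     \<Longrightarrow> Fun f ts \<in> herbrand_universe L"

definition ground_substs ::
  "('p, 'f, 'v) fo_atom problog \<Rightarrow> ('v \<Rightarrow> ('f, 'v) fo_term) set" where
  "ground_substs L = {\<sigma>. \<forall>x. \<sigma> x \<in> herbrand_universe L}"

definition ground_pfacts :: "('p, 'f, 'v) fo_atom problog \<Rightarrow> (real \<times> ('p, 'f, 'v) fo_atom) set" where
  "ground_pfacts L = {(p, subst_atom \<sigma> f) | p f \<sigma>. (p, f) \<in> pfacts L \<and> \<sigma> \<in> ground_substs L}"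

definition ground_rules :: "('p, 'f, 'v) fo_atom problog \<Rightarrow> ('p, 'f, 'v) fo_atom rule set" where
  "ground_rules L = {map_rule (subst_atom \<sigma>) r | r \<sigma>. r \<in> rules L \<and> \<sigma> \<in> ground_substs L}"

definition grounding :: "('p, 'f, 'v) fo_atom problog \<Rightarrow> ('p, 'f, 'v) fo_atom ground_problog" where
  "grounding L =
     \<lparr>pfacts = ground_pfacts L,
      rules = ground_rules L,
      base = program_atoms \<lparr>pfacts = ground_pfacts L, rules = ground_rules L\<rparr>\<rparr>"

definition problog_program :: "('p, 'f, 'v) fo_atom problog \<Rightarrow> bool" where
  "problog_program L \<longleftrightarrow>
     (\<forall>(p, f)\<in>pfacts L. 0 \<le> p \<and> p \<le> 1) \<and>
     finite (prob_atoms (grounding L)) \<and>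
     (\<forall>f\<in>prob_atoms (grounding L). \<exists>!p. (p, f) \<in> pfacts (grounding L)) \<and>
     prob_atoms (grounding L) \<inter> derived_atoms (grounding L) = {}"

text \<open>The set \<open>At\<close> of ground probabilistic and derived atoms.\<close>

definition At :: "('p, 'f, 'v) fo_atom problog \<Rightarrow> ('p, 'f, 'v) fo_atom set" where
  "At L = prob_atoms (grounding L) \<union> derived_atoms (grounding L)"

end

(* The well-founded model of the relevant program is the restriction of that of the whole program
   to the relevant atoms, provided one of the two is a world that satisfies the evidence: an
   inactive rule then has a false body, and an active rule with a relevant head has only relevant
   atoms in its body.  All inclusions between the two models follow from the fact that a least
   fixed point lies below every pre-fixed point.  Hence a total choice yields a world with the
   evidence and the query values if and only if its relevant part does so in the relevant program,
   and the irrelevant probabilistic facts sum out to 1.  Thus even the unconditional probabilities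
   of these events agree. *)
theory Submission
  imports Defs
begin

section \<open>Worlds and total choices\<close>

fun atom_of :: "'a literal \<Rightarrow> 'a" where
  "atom_of (Pos a) = a"
| "atom_of (Neg a) = a"

lemma atoms_of_literal_eq: "atoms_of_literal l = {atom_of l}"
  by (cases l) auto

lemma in_literals_of_world [simp]:
  "Pos a \<in> literals_of_world B \<omega> \<longleftrightarrow> a \<in> \<omega>"
  "Neg a \<in> literals_of_world B \<omega> \<longleftrightarrow> a \<in> B - \<omega>"
  by (auto simp: literals_of_world_def)

lemma compl_in_literals_of_world:
  assumes "\<omega> \<subseteq> B" and "atom_of l \<in> B"
  shows "compl l \<in> literals_of_world B \<omega> \<longleftrightarrow> l \<notin> literals_of_world B \<omega>"
  using assms by (cases l) (auto simp: literals_of_world_def)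

section \<open>The well-founded model as a least fixed point\<close>

lemma WFM_unfold: "WFM B R = wf_step B R (WFM B R)"
  unfolding WFM_def by (rule lfp_unfold[OF mono_wf_step])

lemma WFM_lowerbound: "wf_step B R I \<subseteq> I \<Longrightarrow> WFM B R \<subseteq> I"
  unfolding WFM_def by (rule lfp_lowerbound)

lemma Pos_in_WFM:
  assumes "r \<in> R" and "set (body r) \<subseteq> WFM B R"
  shows "Pos (head r) \<in> WFM B R"
  using assms by (subst WFM_unfold) (auto simp: wf_step_def consequences_def)

lemma Neg_in_WFM:
  assumes "unfounded R (WFM B R) U" and "U \<subseteq> B" and "a \<in> U"
  shows "Neg a \<in> WFM B R"
  using assms by (subst WFM_unfold) (auto simp: wf_step_def greatest_unfounded_def)

lemma wf_step_subsetI: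
  assumes "\<And>r. r \<in> R \<Longrightarrow> set (body r) \<subseteq> I \<Longrightarrow> Pos (head r) \<in> J"
    and "\<And>U a. unfounded R I U \<Longrightarrow> U \<subseteq> B \<Longrightarrow> a \<in> U \<Longrightarrow> Neg a \<in> J"
  shows "wf_step B R I \<subseteq> J"
  using assms unfolding wf_step_def consequences_def greatest_unfounded_def by blast

text \<open>\<open>two_valued\<close> speaks only of atoms in \<open>B\<close>, so literals over
  other atoms have to be excluded as well: the literals over \<open>B\<close> form a pre-fixed
  point, since heads and unfounded sets lie in \<open>B\<close>.\<close>

lemma WFM_two_valued:
  assumes "two_valued B (WFM B R)" and "head ` R \<subseteq> B"
  obtains \<omega> where "\<omega> \<subseteq> B" and "WFM B R = literals_of_world B \<omega>"
proof
  have sub: "WFM B R \<subseteq> {l. atom_of l \<in> B}"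
    by (intro WFM_lowerbound wf_step_subsetI) (use assms(2) in auto)
  show "{a. Pos a \<in> WFM B R} \<subseteq> B"
    using sub by auto
  show "WFM B R = literals_of_world B {a. Pos a \<in> WFM B R}"
  proof (rule set_eqI)
    fix l show "l \<in> WFM B R \<longleftrightarrow> l \<in> literals_of_world B {a. Pos a \<in> WFM B R}"
      using sub assms(1) by (cases l) (auto simp: two_valued_def literals_of_world_def)
  qed
qed

lemma literals_of_world_inj:
  "literals_of_world B \<omega> = literals_of_world B \<omega>' \<Longrightarrow> \<omega> = \<omega>'"
  by (auto simp: literals_of_world_def set_eq_iff image_iff)

section \<open>Well-founded models of total choices\<close>

definition choice_rules :: "'a ground_problog \<Rightarrow> 'a set \<Rightarrow> 'a rule set" where
  "choice_rules G C = (\<lambda>f. Rule f []) ` C \<union> rules G"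

lemma choice_WFM_eq: "choice_WFM G C = WFM (base G) (choice_rules G C)"
  by (simp add: choice_WFM_def choice_rules_def)

lemma choice_WFM_subsetI:
  assumes "\<And>r. r \<in> choice_rules G C \<Longrightarrow> set (body r) \<subseteq> I \<Longrightarrow> Pos (head r) \<in> I"
    and "\<And>U a. unfounded (choice_rules G C) I U \<Longrightarrow> U \<subseteq> base G \<Longrightarrow> a \<in> U \<Longrightarrow> Neg a \<in> I"
  shows "choice_WFM G C \<subseteq> I"
  unfolding choice_WFM_eq by (intro WFM_lowerbound wf_step_subsetI assms)

lemma Pos_in_choice_WFM:
  assumes "r \<in> choice_rules G C" and "set (body r) \<subseteq> choice_WFM G C"
  shows "Pos (head r) \<in> choice_WFM G C"
  using assms unfolding choice_WFM_eq by (rule Pos_in_WFM)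

lemma Neg_in_choice_WFM:
  assumes "unfounded (choice_rules G C) (choice_WFM G C) U" and "U \<subseteq> base G" and "a \<in> U"
  shows "Neg a \<in> choice_WFM G C"
  using assms unfolding choice_WFM_eq by (rule Neg_in_WFM)

text \<open>A chosen fact is a rule with empty body, hence true. An unchosen probabilistic atom
  heads no rule, by disjointness from the derived atoms, so its singleton is unfounded in every
  interpretation.\<close>

lemma choice_of_model:
  assumes "C \<subseteq> prob_atoms G" and "prob_atoms G \<subseteq> base G"
    and "prob_atoms G \<inter> derived_atoms G = {}"
    and "choice_WFM G C = literals_of_world (base G) \<omega>"
  shows "\<omega> \<inter> prob_atoms G = C"
proof -
  have "f \<in> \<omega>" if "f \<in> C" for f
    using Pos_in_choice_WFM[of "Rule f []" G C] that assms(4) by (simp add: choice_rules_def)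
  moreover have "f \<notin> \<omega>" if "f \<in> prob_atoms G" "f \<notin> C" for f
  proof -
    have "unfounded (choice_rules G C) I {f}" for I
      using that assms(3) by (auto simp: unfounded_def choice_rules_def derived_atoms_def)
    from Neg_in_choice_WFM[OF this, of f] show ?thesis
      using that assms(2,4) by auto
  qed
  ultimately show ?thesis
    using assms(1) by blast
qed

section \<open>Event probabilities as finite sums over total choices\<close>

definition event_choices :: "'a ground_problog \<Rightarrow> 'a set set \<Rightarrow> 'a set set" where
  "event_choices G X = {C. C \<subseteq> prob_atoms G \<and>
     (\<exists>\<omega>\<in>worlds G \<inter> X. choice_WFM G C = literals_of_world (base G) \<omega>)}"

text \<open>Models and the choices that yield them determine each other:
  \<open>choice_of_model\<close> recovers the choice, and a choice has only one well-founded model.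
  Worlds that are not models contribute 0.\<close>

lemma event_prob_eq_sum_choices:
  assumes "finite (prob_atoms G)" and "prob_atoms G \<subseteq> base G"
    and "prob_atoms G \<inter> derived_atoms G = {}"
  shows "event_prob G X = (\<Sum>C\<in>event_choices G X. choice_prob G C)"
proof -
  define M where "M = {\<omega> \<in> worlds G \<inter> X. is_model G \<omega>}"
  note choice = choice_of_model[OF _ assms(2,3)]
  have bij: "bij_betw (\<lambda>\<omega>. \<omega> \<inter> prob_atoms G) M (event_choices G X)"
    unfolding bij_betw_def
  proof
    show "inj_on (\<lambda>\<omega>. \<omega> \<inter> prob_atoms G) M"
    proof (rule inj_onI)
      fix \<omega> \<omega>' assume "\<omega> \<in> M" "\<omega>' \<in> M" and eq: "\<omega> \<inter> prob_atoms G = \<omega>' \<inter> prob_atoms G"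
      then obtain C C' where C: "C \<subseteq> prob_atoms G" "choice_WFM G C = literals_of_world (base G) \<omega>"
        and C': "C' \<subseteq> prob_atoms G" "choice_WFM G C' = literals_of_world (base G) \<omega>'"
        by (auto simp: M_def is_model_def)
      have "C = C'"
        using choice[OF C] choice[OF C'] eq by simp
      with C(2) C'(2) show "\<omega> = \<omega>'"
        using literals_of_world_inj by metis
    qed
    show "(\<lambda>\<omega>. \<omega> \<inter> prob_atoms G) ` M = event_choices G X"
    proof (intro set_eqI iffI)
      fix C assume "C \<in> (\<lambda>\<omega>. \<omega> \<inter> prob_atoms G) ` M"
      then obtain \<omega> C' where "C = \<omega> \<inter> prob_atoms G" "\<omega> \<in> worlds G \<inter> X" "C' \<subseteq> prob_atoms G"
        "choice_WFM G C' = literals_of_world (base G) \<omega>"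
        by (auto simp: M_def is_model_def)
      with choice show "C \<in> event_choices G X"
        by (auto simp: event_choices_def)
    next
      fix C assume "C \<in> event_choices G X"
      then obtain \<omega> where \<omega>: "C \<subseteq> prob_atoms G" "\<omega> \<in> worlds G \<inter> X"
        "choice_WFM G C = literals_of_world (base G) \<omega>"
        by (auto simp: event_choices_def)
      then have "\<omega> \<in> M"
        by (auto simp: M_def is_model_def)
      with choice[OF \<omega>(1,3)] show "C \<in> (\<lambda>\<omega>. \<omega> \<inter> prob_atoms G) ` M"
        by blast
    qed
  qed
  have "finite (event_choices G X)"
    by (rule finite_subset[of _ "Pow (prob_atoms G)"]) (auto simp: event_choices_def assms(1))
  then have "finite M"
    using bij bij_betw_finite by blast
  have "event_prob G X = (\<Sum>\<^sub>\<infinity>\<omega>\<in>M. choice_prob G (\<omega> \<inter> prob_atoms G))"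
    unfolding event_prob_def by (rule infsum_cong_neutral) (auto simp: M_def world_prob_def)
  also have "\<dots> = (\<Sum>\<omega>\<in>M. choice_prob G (\<omega> \<inter> prob_atoms G))"
    using \<open>finite M\<close> by simp
  also have "\<dots> = (\<Sum>C\<in>event_choices G X. choice_prob G C)"
    by (rule sum.reindex_bij_betw[OF bij])
  finally show ?thesis .
qed

text \<open>Expand the product over \<open>S\<close> of \<open>p f + (1 - p f)\<close>, each factor
  being 1. This will be the total mass of the choices among irrelevant facts.\<close>

lemma sum_Pow_prod_complement:
  fixes p :: "'a \<Rightarrow> real"
  assumes "finite S"
  shows "(\<Sum>D\<in>Pow S. (\<Prod>f\<in>D. p f) * (\<Prod>f\<in>S - D. 1 - p f)) = 1"
  using prod_add[OF assms, of p "\<lambda>f. 1 - p f"] by simp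


section \<open>The well-founded model of the relevant program\<close>

text \<open>Collects the structural properties of a grounding that the argument uses; two-valuedness
  is a separate premise of the lemmas that rely on it.\<close>

locale relevant_grounding =
  fixes G :: "'a ground_problog" and Q E :: "'a set" and e :: "'a \<Rightarrow> bool"
  assumes query_evidence_base: "Q \<union> E \<subseteq> base G"
    and rules_base: "r \<in> rules G \<Longrightarrow> atoms_of_rule r \<subseteq> base G"
    and prob_atoms_base: "prob_atoms G \<subseteq> base G"
    and prob_atoms_derived_atoms: "prob_atoms G \<inter> derived_atoms G = {}"
    and finite_prob_atoms: "finite (prob_atoms G)"
begin

abbreviation A where "A \<equiv> relevant_atoms G Q E e"
abbreviation H where "H \<equiv> relevant_program G Q E e"

lemma A_base: "A \<subseteq> base G"
proof
  fix a assume "a \<in> A" then show "a \<in> base G"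
  proof (induction rule: relevant_atoms.induct)
    case (backchain r l a)
    then have "a \<in> atoms_of_rule r"
      by (cases r) auto
    with backchain rules_base show ?case by blast
  qed (use query_evidence_base in auto)
qed

lemma query_evidence_A: "Q \<union> E \<subseteq> A"
  by (auto intro: relevant_atoms.start)

lemma base_H [simp]: "base H = A"
  by (simp add: relevant_program_def)

lemma prob_atoms_H: "prob_atoms H = prob_atoms G \<inter> A"
  by (force simp: relevant_program_def prob_atoms_def)

lemma rules_H: "rules H = {r \<in> rules G. \<not> inactive E e r \<and> head r \<in> A}"
  by (simp add: relevant_program_def)

lemma fact_prob_H: "f \<in> A \<Longrightarrow> fact_prob H f = fact_prob G f"
  by (simp add: relevant_program_def fact_prob_def)

text \<open>A fact has an empty body and is never inactive, so one filter describes both the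
  restricted choice and the remaining rules.\<close>

lemma choice_rules_H:
  "choice_rules H (C \<inter> A) = {r \<in> choice_rules G C. \<not> inactive E e r \<and> head r \<in> A}"
  by (auto simp: choice_rules_def rules_H inactive_def)

lemma body_relevant:
  assumes "r \<in> choice_rules H (C \<inter> A)" and "l \<in> set (body r)"
  shows "atom_of l \<in> A"
  using assms relevant_atoms.backchain[of r G E e Q l "atom_of l"]
  by (auto simp: choice_rules_def rules_H atoms_of_literal_eq)

section \<open>Comparison of the two well-founded models under the evidence\<close>

lemma false_in_evidence_literals_of_world:
  assumes "false_in_evidence E e l" and "\<omega> \<in> assignment_event E e" and "A \<subseteq> B"
  shows "l \<notin> literals_of_world B \<omega>" and "compl l \<in> literals_of_world B \<omega>" and "atom_of l \<in> A"
  using assms query_evidence_A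
  by (cases l; auto simp: literals_of_world_def assignment_event_def)+

lemma choice_WFM_relevant:
  assumes M: "choice_WFM G C = literals_of_world (base G) \<omega>" (is "?M = _")
    and "\<omega> \<subseteq> base G" and ev: "\<omega> \<in> assignment_event E e"
  shows "choice_WFM H (C \<inter> A) = literals_of_world A (\<omega> \<inter> A)" (is "?N = _")
proof -
  note evidence = false_in_evidence_literals_of_world[OF _ ev A_base, folded M]
  have active: "\<not> inactive E e r" if "set (body r) \<subseteq> ?M" for r
    using that evidence(1) unfolding inactive_def by blast
  have "?N \<subseteq> {l \<in> ?M. atom_of l \<in> A}" (is "_ \<subseteq> ?T")
  proof (rule choice_WFM_subsetI)
    fix r assume "r \<in> choice_rules H (C \<inter> A)" "set (body r) \<subseteq> ?T"
    then show "Pos (head r) \<in> ?T"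
      using Pos_in_choice_WFM[of r G C] by (auto simp: choice_rules_H)
  next
    fix U a assume U: "unfounded (choice_rules H (C \<inter> A)) ?T U" "U \<subseteq> base H" "a \<in> U"
    \<comment> \<open>As \<open>U\<close> is contained in \<open>A\<close>, a rule with head in
      \<open>U\<close> that is missing from the relevant program is inactive. The evidence then puts
      the complement of one of its body literals into \<open>?M\<close>.\<close>
    have "unfounded (choice_rules G C) ?M U"
      unfolding unfounded_def
    proof (intro ballI impI)
      fix r assume r: "r \<in> choice_rules G C" "head r \<in> U"
      show "(\<exists>l\<in>set (body r). compl l \<in> ?M) \<or> (\<exists>b\<in>U. Pos b \<in> set (body r))"
      proof (cases "inactive E e r")
        case True
        then show ?thesis using evidence(2) unfolding inactive_def by blast
      next
        case False
        with r U have "r \<in> choice_rules H (C \<inter> A)"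
          by (auto simp: choice_rules_H)
        with r U(1) show ?thesis unfolding unfounded_def by blast
      qed
    qed
    from Neg_in_choice_WFM[OF this] U A_base show "Neg a \<in> ?T"
      by auto
  qed
  \<comment> \<open>Since \<open>?P\<close> keeps membership in \<open>?M\<close>, a rule with body
    in \<open>?P\<close> has a true body and is therefore active.\<close>
  moreover have "?M \<subseteq> {l \<in> ?M. atom_of l \<in> A \<longrightarrow> l \<in> ?N}" (is "_ \<subseteq> ?P")
  proof (rule choice_WFM_subsetI)
    fix r assume r: "r \<in> choice_rules G C" "set (body r) \<subseteq> ?P"
    have "Pos (head r) \<in> ?N" if "head r \<in> A"
    proof -
      have "r \<in> choice_rules H (C \<inter> A)"
        using r active that by (auto simp: choice_rules_H)
      with r(2) show ?thesis
        using body_relevant by (intro Pos_in_choice_WFM) blast+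
    qed
    then show "Pos (head r) \<in> ?P"
      using r Pos_in_choice_WFM[of r G C] by auto
  next
    fix U a assume U: "unfounded (choice_rules G C) ?P U" "U \<subseteq> base G" "a \<in> U"
    have "unfounded (choice_rules G C) ?M U"
      using U(1) unfolding unfounded_def by blast
    then have "Neg a \<in> ?M"
      using U(2,3) by (rule Neg_in_choice_WFM)
    \<comment> \<open>Bodies of relevant rules mention only atoms of \<open>A\<close>, so either
      witness of unfoundedness survives the restriction to \<open>A\<close>.\<close>
    moreover have "unfounded (choice_rules H (C \<inter> A)) ?N (U \<inter> A)"
      unfolding unfounded_def
    proof (intro ballI impI)
      fix r assume r: "r \<in> choice_rules H (C \<inter> A)" "head r \<in> U \<inter> A"
      then have "(\<exists>l\<in>set (body r). compl l \<in> ?P) \<or> (\<exists>b\<in>U. Pos b \<in> set (body r))"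
        using U(1) unfolding unfounded_def choice_rules_H by blast
      moreover have "atom_of l \<in> A \<and> atom_of (compl l) \<in> A" if "l \<in> set (body r)" for l
        using body_relevant[OF r(1) that] by (cases l) auto
      moreover have "b \<in> A" if "Pos b \<in> set (body r)" for b
        using body_relevant[OF r(1) that] by simp
      ultimately show
        "(\<exists>l\<in>set (body r). compl l \<in> ?N) \<or> (\<exists>b\<in>U \<inter> A. Pos b \<in> set (body r))"
        by blast
    qed
    then have "Neg a \<in> ?N" if "a \<in> A"
      using U(3) that Neg_in_choice_WFM[of H "C \<inter> A" "U \<inter> A" a] by simp
    ultimately show "Neg a \<in> ?P" by simp
  qed
  ultimately have "?N = {l \<in> ?M. atom_of l \<in> A}"
    by blast
  also have "\<dots> = literals_of_world A (\<omega> \<inter> A)"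
    using A_base by (auto simp: M literals_of_world_def)
  finally show ?thesis .
qed

text \<open>Now the evidence is known in the relevant model only, so the pre-fixed point
  \<open>?P\<close> leaves literals over irrelevant atoms unconstrained. One inclusion is enough,
  because two-valuedness of both models later turns it into agreement on \<open>A\<close>.\<close>

lemma choice_WFM_extend:
  assumes N: "choice_WFM H (C \<inter> A) = literals_of_world A \<omega>" (is "?N = _")
    and "\<omega> \<subseteq> A" and ev: "\<omega> \<in> assignment_event E e"
    and l: "l \<in> choice_WFM G C" "atom_of l \<in> A"
  shows "l \<in> literals_of_world A \<omega>"
proof -
  note evidence = false_in_evidence_literals_of_world[OF _ ev order_refl, folded N]
  let ?P = "{l. atom_of l \<in> A \<longrightarrow> l \<in> ?N}"
  have "choice_WFM G C \<subseteq> ?P"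
  proof (rule choice_WFM_subsetI)
    fix r assume r: "r \<in> choice_rules G C" "set (body r) \<subseteq> ?P"
    have "Pos (head r) \<in> ?N" if "head r \<in> A"
    proof -
      \<comment> \<open>A body literal false in the evidence has a relevant atom, so
        \<open>?P\<close> would place it in \<open>?N\<close>, where it is false.\<close>
      have "\<not> inactive E e r"
        using r(2) evidence(1,3) unfolding inactive_def by blast
      with r that have "r \<in> choice_rules H (C \<inter> A)"
        by (auto simp: choice_rules_H)
      with r(2) show ?thesis
        using body_relevant by (intro Pos_in_choice_WFM) blast+
    qed
    then show "Pos (head r) \<in> ?P" by simp
  next
    fix U a assume U: "unfounded (choice_rules G C) ?P U" "U \<subseteq> base G" "a \<in> U"
    \<comment> \<open>The first atom of \<open>U\<close> to be derived in the relevant program would need a rule whose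
      body is true before, contradicting unfoundedness.\<close>
    have "?N \<subseteq> {l \<in> ?N. \<forall>b\<in>U. l \<noteq> Pos b}" (is "_ \<subseteq> ?T")
    proof (rule choice_WFM_subsetI)
      fix r assume r: "r \<in> choice_rules H (C \<inter> A)" "set (body r) \<subseteq> ?T"
      have "head r \<notin> U"
      proof
        assume "head r \<in> U"
        \<comment> \<open>The other alternative, a positive body atom in \<open>U\<close>, is ruled
          out by \<open>?T\<close>.\<close>
        then obtain l where l: "l \<in> set (body r)" "compl l \<in> ?P"
          using r U(1) unfolding unfounded_def choice_rules_H by blast
        have A: "atom_of l \<in> A"
          using r(1) l(1) by (rule body_relevant)
        then have "compl l \<in> ?N"
          using l(2) by (cases l) auto
        moreover have "l \<in> ?N"
          using l(1) r(2) by blast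
        ultimately show False
          using compl_in_literals_of_world[OF \<open>\<omega> \<subseteq> A\<close> A] by (simp add: N)
      qed
      moreover have "Pos (head r) \<in> ?N"
        using r by (intro Pos_in_choice_WFM) auto
      ultimately show "Pos (head r) \<in> ?T" by auto
    next
      fix V b assume V: "unfounded (choice_rules H (C \<inter> A)) ?T V" "V \<subseteq> base H" "b \<in> V"
      then have "unfounded (choice_rules H (C \<inter> A)) ?N V"
        unfolding unfounded_def by blast
      then have "Neg b \<in> ?N"
        using V(2,3) by (rule Neg_in_choice_WFM)
      then show "Neg b \<in> ?T" by simp
    qed
    then have "Pos a \<notin> ?N"
      using U(3) by blast
    \<comment> \<open>Two-valuedness of the relevant model turns underivability into
      falsity.\<close>
    then have "Neg a \<in> ?N" if "a \<in> A"
      using that by (simp add: N)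
    then show "Neg a \<in> ?P" by simp
  qed
  with l N show ?thesis by blast
qed

text \<open>The conditions on \<open>X\<close> say that the event entails the evidence and depends
  on relevant atoms only; they allow worlds to be restricted to \<open>A\<close> and extended
  again.\<close>

lemma event_choices_relevant:
  assumes two_valued: "\<And>C. C \<subseteq> prob_atoms G \<Longrightarrow> two_valued (base G) (choice_WFM G C)"
    and "C \<subseteq> prob_atoms G"
    and X: "X \<subseteq> assignment_event E e" "\<And>\<omega>. \<omega> \<in> X \<longleftrightarrow> \<omega> \<inter> A \<in> X"
  shows "C \<in> event_choices G X \<longleftrightarrow> C \<inter> A \<in> event_choices H X"
proof
  assume "C \<in> event_choices G X"
  then obtain \<omega> where "\<omega> \<subseteq> base G" "\<omega> \<in> X" "choice_WFM G C = literals_of_world (base G) \<omega>"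
    by (auto simp: event_choices_def worlds_def)
  then have "choice_WFM H (C \<inter> A) = literals_of_world A (\<omega> \<inter> A)" "\<omega> \<inter> A \<in> X"
    using choice_WFM_relevant X by blast+
  then show "C \<inter> A \<in> event_choices H X"
    using \<open>C \<subseteq> prob_atoms G\<close> by (auto simp: event_choices_def worlds_def prob_atoms_H)
next
  assume "C \<inter> A \<in> event_choices H X"
  then obtain \<omega> where \<omega>: "\<omega> \<subseteq> A" "\<omega> \<in> X" "choice_WFM H (C \<inter> A) = literals_of_world A \<omega>"
    by (auto simp: event_choices_def worlds_def)
  have "head ` choice_rules G C \<subseteq> base G"
    using \<open>C \<subseteq> prob_atoms G\<close> prob_atoms_base rules_base
    by (force simp: choice_rules_def intro: rule.set_sel)
  then obtain \<omega>' where \<omega>': "\<omega>' \<subseteq> base G" "choice_WFM G C = literals_of_world (base G) \<omega>'"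
    using WFM_two_valued[of "base G" "choice_rules G C"] two_valued[OF \<open>C \<subseteq> prob_atoms G\<close>]
    unfolding choice_WFM_eq by blast
  \<comment> \<open>The inclusion of \<open>choice_WFM_extend\<close> is applied to both
    \<open>Pos a\<close> and \<open>Neg a\<close>, one of which is true in the full model.\<close>
  have "a \<in> \<omega>' \<longleftrightarrow> a \<in> \<omega>" if "a \<in> A" for a
  proof -
    have "l \<in> literals_of_world A \<omega>" if "l \<in> literals_of_world (base G) \<omega>'" "atom_of l \<in> A" for l
      using choice_WFM_extend[OF \<omega>(3,1)] \<omega>(2) X(1) that \<omega>'(2) by blast
    from this[of "Pos a"] this[of "Neg a"] show ?thesis
      using that A_base by auto
  qed
  then have "\<omega>' \<inter> A = \<omega>"
    using \<omega>(1) by blast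
  with \<omega>(2) X(2) have "\<omega>' \<in> X" by metis
  with \<omega>' show "C \<in> event_choices G X"
    using \<open>C \<subseteq> prob_atoms G\<close> by (auto simp: event_choices_def worlds_def)
qed

section \<open>Summing out the irrelevant probabilistic facts\<close>

lemma choice_prob_Un:
  assumes C: "C \<subseteq> prob_atoms H" and D: "D \<subseteq> prob_atoms G - A"
  shows "choice_prob G (C \<union> D) = choice_prob H C *
    ((\<Prod>f\<in>D. fact_prob G f) * (\<Prod>f\<in>prob_atoms G - A - D. 1 - fact_prob G f))"
proof -
  have "finite C" "finite D"
    using C D finite_prob_atoms by (auto simp: prob_atoms_H intro: finite_subset)
  moreover have "C \<inter> D = {}"
    using C D by (auto simp: prob_atoms_H)
  moreover have "prob_atoms G - (C \<union> D) = (prob_atoms H - C) \<union> (prob_atoms G - A - D)"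
    using C D by (auto simp: prob_atoms_H)
  moreover have "(prob_atoms H - C) \<inter> (prob_atoms G - A - D) = {}"
    by (auto simp: prob_atoms_H)
  moreover have "(\<Prod>f\<in>C. fact_prob H f) = (\<Prod>f\<in>C. fact_prob G f)"
    using C by (intro prod.cong) (auto simp: prob_atoms_H fact_prob_H)
  moreover have "(\<Prod>f\<in>prob_atoms H - C. 1 - fact_prob H f) = (\<Prod>f\<in>prob_atoms H - C. 1 - fact_prob G f)"
    by (intro prod.cong) (auto simp: prob_atoms_H fact_prob_H)
  ultimately show ?thesis
    using finite_prob_atoms by (simp add: choice_prob_def prod.union_disjoint prob_atoms_H)
qed

text \<open>The choices yielding \<open>X\<close> form a product: a choice yielding \<open>X\<close>
  in the relevant program, joined with an arbitrary set of irrelevant facts. Probabilities factor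
  accordingly, and the second factor sums to 1.\<close>

lemma event_prob_relevant:
  assumes two_valued: "\<And>C. C \<subseteq> prob_atoms G \<Longrightarrow> two_valued (base G) (choice_WFM G C)"
    and X: "X \<subseteq> assignment_event E e" "\<And>\<omega>. \<omega> \<in> X \<longleftrightarrow> \<omega> \<inter> A \<in> X"
  shows "event_prob G X = event_prob H X"
proof -
  let ?D = "prob_atoms G - A"
  have "event_prob G X = (\<Sum>C\<in>event_choices G X. choice_prob G C)"
    using finite_prob_atoms prob_atoms_base prob_atoms_derived_atoms
    by (rule event_prob_eq_sum_choices)
  also have "\<dots> = (\<Sum>(C, D)\<in>event_choices H X \<times> Pow ?D. choice_prob G (C \<union> D))"
  proof (rule sum.reindex_bij_witness[where i = "\<lambda>(C, D). C \<union> D" and j = "\<lambda>C. (C \<inter> A, C - A)"])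
    fix C assume C: "C \<in> event_choices G X"
    then have "C \<subseteq> prob_atoms G"
      by (simp add: event_choices_def)
    with C show "(C \<inter> A, C - A) \<in> event_choices H X \<times> Pow ?D"
      using event_choices_relevant[OF two_valued _ X] by auto
    show "(case (C \<inter> A, C - A) of (C, D) \<Rightarrow> C \<union> D) = C"
      by auto
    show "(case (C \<inter> A, C - A) of (C, D) \<Rightarrow> choice_prob G (C \<union> D)) = choice_prob G C"
      by (simp add: Int_Diff_Un)
  next
    fix CD assume "CD \<in> event_choices H X \<times> Pow ?D"
    then obtain C D where CD: "CD = (C, D)" "C \<in> event_choices H X" "D \<subseteq> ?D"
      by auto
    then have C: "C \<subseteq> prob_atoms G \<inter> A"
      by (simp add: event_choices_def prob_atoms_H)
    then have parts: "(C \<union> D) \<inter> A = C" "(C \<union> D) - A = D"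
      using CD by auto
    then show "((case CD of (C, D) \<Rightarrow> C \<union> D) \<inter> A, (case CD of (C, D) \<Rightarrow> C \<union> D) - A) = CD"
      using CD by simp
    show "(case CD of (C, D) \<Rightarrow> C \<union> D) \<in> event_choices G X"
      using CD C parts event_choices_relevant[OF two_valued _ X, of "C \<union> D"] by auto
  qed
  also have "\<dots> = (\<Sum>C\<in>event_choices H X. \<Sum>D\<in>Pow ?D. choice_prob G (C \<union> D))"
    by (rule sum.cartesian_product[symmetric])
  also have "\<dots> = (\<Sum>C\<in>event_choices H X. choice_prob H C)"
  proof (rule sum.cong[OF refl])
    fix C assume "C \<in> event_choices H X"
    then have "C \<subseteq> prob_atoms H"
      by (simp add: event_choices_def)
    then have "(\<Sum>D\<in>Pow ?D. choice_prob G (C \<union> D)) = choice_prob H C *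
        (\<Sum>D\<in>Pow ?D. (\<Prod>f\<in>D. fact_prob G f) * (\<Prod>f\<in>?D - D. 1 - fact_prob G f))"
      unfolding sum_distrib_left by (intro sum.cong refl choice_prob_Un) auto
    also have "\<dots> = choice_prob H C"
      using finite_prob_atoms by (simp add: sum_Pow_prod_complement)
    finally show "(\<Sum>D\<in>Pow ?D. choice_prob G (C \<union> D)) = choice_prob H C" .
  qed
  also have "\<dots> = event_prob H X"
    using finite_prob_atoms prob_atoms_derived_atoms
    by (intro event_prob_eq_sum_choices[symmetric])
      (auto simp: prob_atoms_H derived_atoms_def rules_H)
  finally show ?thesis .
qed

end

section \<open>Passage from ground programs to first-order programs\<close>

theorem theorem1:
  fixes L :: "('p, 'f, 'v) fo_atom problog"
    and Q E :: "('p, 'f, 'v) fo_atom set"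
    and e q :: "('p, 'f, 'v) fo_atom \<Rightarrow> bool"
  assumes "problog_program L"
    and "\<forall>C\<subseteq>prob_atoms (grounding L).
           two_valued (base (grounding L)) (choice_WFM (grounding L) C)"
    and "Q \<subseteq> At L"
    and "E \<subseteq> At L"
    and "event_prob (grounding L) (assignment_event E e) > 0"
  shows "cond_event_prob (grounding L) (assignment_event Q q) (assignment_event E e) =
         cond_event_prob (relevant_program (grounding L) Q E e)
           (assignment_event Q q) (assignment_event E e)"
proof -
  let ?G = "grounding L"
  have base: "base ?G = prob_atoms ?G \<union> (\<Union>r\<in>rules ?G. atoms_of_rule r)"
    by (simp add: grounding_def program_atoms_def prob_atoms_def)
  then have "At L \<subseteq> base ?G"
    by (auto simp: At_def derived_atoms_def intro: rule.set_sel)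
  then interpret relevant_grounding ?G Q E e
    using assms(1,3,4) base by unfold_locales (auto simp: problog_program_def)
  \<comment> \<open>All query and evidence atoms are relevant, so these events meet the locality
    condition of \<open>event_prob_relevant\<close>.\<close>
  have local: "\<omega> \<in> assignment_event Y v \<longleftrightarrow> \<omega> \<inter> A \<in> assignment_event Y v"
    if "Y \<subseteq> Q \<union> E" for Y v \<omega>
    using that query_evidence_A unfolding assignment_event_def by blast
  have "event_prob ?G (assignment_event E e) = event_prob H (assignment_event E e)"
    using assms(2) local[of E] by (intro event_prob_relevant) auto
  \<comment> \<open>Intersecting with the evidence event makes the query event entail the
    evidence.\<close>
  moreover have "event_prob ?G (assignment_event Q q \<inter> assignment_event E e) =
      event_prob H (assignment_event Q q \<inter> assignment_event E e)"
    using assms(2) local[of E] local[of Q] by (intro event_prob_relevant) auto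
  ultimately show ?thesis
    by (simp add: cond_event_prob_def)
qed

end
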